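(* Let $x\cdot A=y$ be a left system of linear equations with matrix of coefficients $A\in \mathrm{M}(n,\mathbf{H})$, row of constants $y=(y_1,\ldots,y_n)\in\mathbf{H}^{1\times n}$ and row of unknowns $x=(x_1,\ldots,x_n)$. If $A$ is Hermitian and $\det A\neq 0$, then the unique solution vector $x$ of the system is given by $$x_i=\frac{\mathrm{rdet}_i\,A_{i.}(y)}{\det A},\qquad i=1,\ldots,n.$$
   Context: $\mathbf{H}$ is the skew field of real quaternions; $\mathrm{M}(n,\mathbf{H})$ is the ring of $n\times n$ matrices over $\mathbf{H}$; a matrix $A$ is Hermitian if it equals its conjugate transpose $A^*$. Row determinants: for $A=(a_{pq})\in \mathrm{M}(n,\mathbf{H})$ and $i\in\{1,\ldots,n\}$, $$\mathrm{rdet}_i A=\sum_{\sigma\in S_n}(-1)^{n-r}a_{i\,i_{k_1}}a_{i_{k_1}i_{k_1+1}}\cdots a_{i_{k_1+l_1}i}\cdots a_{i_{k_r}i_{k_r+1}}\cdots a_{i_{k_r+l_r}i_{k_r}},$$ where each $\sigma\in S_n$ is written as a product of its $r$ disjoint cycles (fixed points included) $\sigma=(i\,i_{k_1}i_{k_1+1}\ldots i_{k_1+l_1})(i_{k_2}\ldots i_{k_2+l_2})\ldots(i_{k_r}\ldots i_{k_r+l_r})$, each entry of a cycle being mapped to the next; the first cycle starts with $i$, every other cycle starts with its smallest element, and $i_{k_2}<i_{k_3}<\cdots<i_{k_r}$. A fixed point $p$ contributes the factor $a_{pp}$. For Hermitian $A\in \mathrm{M}(n,\mathbf{H})$ all row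 determinants $\mathrm{rdet}_iA$ coincide and are real; the common value is denoted $\det A$. $A_{i.}(v)$ denotes the matrix obtained from $A$ by replacing its $i$th row with the row $v$. *)

theory Defs
  imports Complex_Main "HOL-Combinatorics.Cycles" "Jordan_Normal_Form.Matrix"
begin

section \<open>The skew field of real quaternions\<close>

text \<open>\<^term>\<open>Quat a b c d\<close> below stands for $a + b\,i + c\,j + d\,k$ with
  $i^2 = j^2 = k^2 = ijk = -1$.\<close>

datatype quat = Quat (qre: real) (qim1: real) (qim2: real) (qim3: real)

lemma quat_eq_iff:
  "p = q \<longleftrightarrow> qre p = qre q \<and> qim1 p = qim1 q \<and> qim2 p = qim2 q \<and> qim3 p = qim3 q"
  by (auto simp: quat.expand)

definition quat_cnj :: "quat \<Rightarrow> quat" where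
  "quat_cnj q = Quat (qre q) (- qim1 q) (- qim2 q) (- qim3 q)"

instantiation quat :: real_vector
begin

definition "0 = Quat 0 0 0 0"
definition "p + q = Quat (qre p + qre q) (qim1 p + qim1 q) (qim2 p + qim2 q) (qim3 p + qim3 q)"
definition "- q = Quat (- qre q) (- qim1 q) (- qim2 q) (- qim3 q)"
definition "p - q = Quat (qre p - qre q) (qim1 p - qim1 q) (qim2 p - qim2 q) (qim3 p - qim3 q)"
definition "scaleR r q = Quat (r * qre q) (r * qim1 q) (r * qim2 q) (r * qim3 q)"

instance
  by standard
    (simp_all add: quat_eq_iff zero_quat_def plus_quat_def uminus_quat_def minus_quat_def
      scaleR_quat_def algebra_simps)

end

instantiation quat :: real_div_algebra
begin

definition "1 = Quat 1 0 0 0"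
definition "p * q = Quat
  (qre p * qre q - qim1 p * qim1 q - qim2 p * qim2 q - qim3 p * qim3 q)
  (qre p * qim1 q + qim1 p * qre q + qim2 p * qim3 q - qim3 p * qim2 q)
  (qre p * qim2 q - qim1 p * qim3 q + qim2 p * qre q + qim3 p * qim1 q)
  (qre p * qim3 q + qim1 p * qim2 q - qim2 p * qim1 q + qim3 p * qre q)"
definition "inverse q =
  scaleR (1 / ((qre q)\<^sup>2 + (qim1 q)\<^sup>2 + (qim2 q)\<^sup>2 + (qim3 q)\<^sup>2)) (quat_cnj q)"
definition "p div (q::quat) = p * inverse q"

instance
proof
  fix q :: quat
  assume "q \<noteq> 0"
  then have pos: "(qre q)\<^sup>2 + (qim1 q)\<^sup>2 + (qim2 q)\<^sup>2 + (qim3 q)\<^sup>2 \<noteq> 0"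
    by (simp add: quat_eq_iff zero_quat_def add_nonneg_eq_0_iff)
  then show "inverse q * q = 1" "q * inverse q = 1"
    by (simp_all add: quat_eq_iff one_quat_def times_quat_def inverse_quat_def scaleR_quat_def
        quat_cnj_def divide_simps power2_eq_square)
qed (simp_all add: quat_eq_iff zero_quat_def one_quat_def plus_quat_def uminus_quat_def
      scaleR_quat_def times_quat_def inverse_quat_def divide_quat_def quat_cnj_def algebra_simps)

end


section \<open>Hermitian quaternionic matrices\<close>

definition conj_transpose :: "quat mat \<Rightarrow> quat mat" where
  "conj_transpose A = map_mat quat_cnj (transpose_mat A)"

definition hermitian_mat :: "quat mat \<Rightarrow> bool" where
  "hermitian_mat A \<longleftrightarrow> conj_transpose A = A"


section \<open>Row determinants\<close>

text \<open>Rows and columns are numbered from 0, as in \<^theory>\<open>Jordan_Normal_Form.Matrix\<close>.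

  For a permutation \<open>\<sigma>\<close>, \<^term>\<open>support \<sigma> p\<close> is the list
  $p, \sigma(p), \sigma^2(p), \ldots$ of the entries of the cycle through \<open>p\<close>, written starting
  with \<open>p\<close>; it is \<open>[p]\<close> for a fixed point. The list \<open>cycle_heads\<close> consists of the first entries of
  all cycles of \<open>\<sigma>\<close> (fixed points included), in the order in which the cycles are written:
  \<open>i\<close> first, then the smallest elements of the remaining cycles in increasing order.
  So its length is the number of cycles.\<close>

definition cycle_heads :: "nat \<Rightarrow> nat \<Rightarrow> (nat \<Rightarrow> nat) \<Rightarrow> nat list" where
  "cycle_heads n i \<sigma> =
     i # filter (\<lambda>p. i \<notin> set (support \<sigma> p) \<and> p = Min (set (support \<sigma> p))) [0..<n]"

text \<open>All products below are taken from left to right.\<close>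

definition cycle_prod :: "'a::ring_1 mat \<Rightarrow> (nat \<Rightarrow> nat) \<Rightarrow> nat \<Rightarrow> 'a" where
  "cycle_prod A \<sigma> p = prod_list (map (\<lambda>q. A $$ (q, \<sigma> q)) (support \<sigma> p))"

definition rdet :: "nat \<Rightarrow> 'a::ring_1 mat \<Rightarrow> 'a" where
  "rdet i A = (\<Sum>\<sigma> | \<sigma> permutes {0..<dim_row A}.
     (- 1) ^ (dim_row A - length (cycle_heads (dim_row A) i \<sigma>)) *
     prod_list (map (cycle_prod A \<sigma>) (cycle_heads (dim_row A) i \<sigma>)))"

text \<open>The determinant of a Hermitian matrix is the common real value of its row determinants.
  It is meaningful only for Hermitian matrices with at least one row.\<close>

definition hermitian_det :: "quat mat \<Rightarrow> real" where
  "hermitian_det A = (THE d. \<forall>i<dim_row A. rdet i A = of_real d)"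

definition replace_row :: "'a mat \<Rightarrow> nat \<Rightarrow> 'a vec \<Rightarrow> 'a mat" where
  "replace_row A i v =
     mat (dim_row A) (dim_col A) (\<lambda>(p, q). if p = i then v $ q else A $$ (p, q))"

end

theory Submission
  imports Defs
begin

text \<open>
  The row determinant of a quaternionic matrix multiplies the entries along each cycle of a
  permutation in cyclic order. Reversing the direction of one cycle of \<open>\<sigma>\<close> changes neither the sign
  of the term nor its other factors, and where the matrix is Hermitian it conjugates the factor of
  that cycle. Averaging \<open>\<sigma>\<close> with its reversal therefore replaces the factor by its real part, a
  central element (\<open>rdet_real_parts\<close>). The real part of a product is invariant under cyclic rotation
  of the factors, so the result does not depend on where each cycle starts or on the order of the
  cycles. For a Hermitian \<open>A\<close> this shows that all row determinants equal one real number
  (\<open>rdet_hermitian_on\<close>).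

  The alternating property survives in the following form: if row \<open>i\<close> of a Hermitian matrix is
  replaced by its row \<open>k \<noteq> i\<close>, the \<open>i\<close>-th row determinant vanishes (\<open>rdet_equal_rows\<close>). Composition
  with the transposition of \<open>i\<close> and \<open>k\<close> pairs the permutations that have \<open>i\<close> and \<open>k\<close> in different
  cycles, with factors \<open>c\<^sub>i\<close> and \<open>c\<^sub>k\<close>, with those in which these two cycles are merged into one with
  factor \<open>c\<^sub>k c\<^sub>i\<close>. The signs are opposite, and after the cycle of \<open>k\<close> is averaged with its
  reversal the terms cancel.

  The factor of row \<open>i\<close> stands leftmost in every term of the \<open>i\<close>-th row determinant, so this
  determinant is left linear in row \<open>i\<close> (\<open>rdet_replace_row_expand\<close>). With the two previous facts, the
  matrix \<open>B\<close> of cofactors divided by \<open>det A\<close> satisfies \<open>A B = 1\<close>. Taking conjugate transposes gives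
  \<open>B\<^sup>* A = 1\<close>, hence \<open>B\<^sup>* = B\<^sup>* (A B) = B\<close>, and \<open>B\<close> is a two-sided inverse. So \<open>x A = y\<close> has the unique
  solution \<open>y B\<close>, and left linearity identifies the entries of \<open>y B\<close> with the quotients of Cramer's
  rule.
\<close>

section \<open>Cycles of a permutation as lists\<close>

definition cycle_through :: "('a \<Rightarrow> 'a) \<Rightarrow> 'a \<Rightarrow> 'a list" where
  "cycle_through f p = support f p"

text \<open>A duplicate-free list is the cycle through its head as soon as \<open>f\<close> acts on it as a rotation by
  one place. Together with the converse for permutations below, this makes it possible to find
  cycles of modified permutations without computing powers.\<close>

lemma cycle_through_eqI:
  assumes ne: "cs \<noteq> []" and d: "distinct cs" and rot: "map f cs = rotate1 cs"
  shows "cycle_through f (hd cs) = cs"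
proof -
  let ?m = "length cs"
  have m0: "0 < ?m" using ne by simp
  have nxt: "f (cs ! j) = cs ! (Suc j mod ?m)" if "j < ?m" for j
  proof -
    have "f (cs ! j) = map f cs ! j" using that by simp
    also have "\<dots> = cs ! (Suc j mod ?m)" unfolding rot using that by (rule nth_rotate1)
    finally show ?thesis .
  qed
  have pow: "(f ^^ j) (hd cs) = cs ! (j mod ?m)" for j
  proof (induction j)
    case 0
    then show ?case using ne by (simp add: hd_conv_nth)
  next
    case (Suc j)
    have "(f ^^ Suc j) (hd cs) = cs ! (Suc (j mod ?m) mod ?m)"
      using Suc nxt[of "j mod ?m"] m0 by simp
    then show ?case by (simp add: mod_Suc_eq)
  qed
  have "least_power f (hd cs) = ?m"
    unfolding least_power_def
  proof (rule Least_equality)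
    show "(f ^^ ?m) (hd cs) = hd cs \<and> 0 < ?m" using pow[of ?m] m0 ne by (simp add: hd_conv_nth)
  next
    fix j assume j: "(f ^^ j) (hd cs) = hd cs \<and> 0 < j"
    show "?m \<le> j"
    proof (rule ccontr)
      assume "\<not> ?m \<le> j"
      then have lt: "j < ?m" by simp
      then have "cs ! j = cs ! 0" using j pow[of j] ne by (simp add: hd_conv_nth)
      then have "j = 0" using d lt m0 nth_eq_iff_index_eq by blast
      then show False using j by simp
    qed
  qed
  then show ?thesis
    unfolding cycle_through_def by (intro nth_equalityI) (simp_all add: pow)
qed

lemma cycle_through_permutation:
  assumes "permutation f"
  shows "cycle_through f p \<noteq> []" "hd (cycle_through f p) = p"
    "distinct (cycle_through f p)" "map f (cycle_through f p) = rotate1 (cycle_through f p)"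
proof -
  let ?m = "least_power f p"
  have m0: "0 < ?m" and fm: "(f ^^ ?m) p = p" using least_power_of_permutation[OF assms] by blast+
  show ne: "cycle_through f p \<noteq> []" using m0 by (simp add: cycle_through_def)
  show "hd (cycle_through f p) = p"
    using m0 ne by (simp add: cycle_through_def hd_conv_nth)
  show "distinct (cycle_through f p)"
    unfolding cycle_through_def by (rule cycle_of_permutation[OF assms])
  show "map f (cycle_through f p) = rotate1 (cycle_through f p)"
  proof (rule nth_equalityI)
    fix j assume "j < length (map f (cycle_through f p))"
    then have j: "j < ?m" by (simp add: cycle_through_def)
    have "map f (cycle_through f p) ! j = (f ^^ Suc j) p" using j by (simp add: cycle_through_def)
    also have "\<dots> = (f ^^ (Suc j mod ?m)) p"
      proof (cases "Suc j = ?m")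
      case True
      then show ?thesis using fm by (metis funpow_0 mod_self)
    next
      case False
      then show ?thesis using j by (simp del: funpow.simps)
    qed
    also have "\<dots> = rotate1 (cycle_through f p) ! j"
      using j m0 by (simp add: cycle_through_def nth_rotate1 del: funpow.simps)
    finally show "map f (cycle_through f p) ! j = rotate1 (cycle_through f p) ! j" .
  qed simp
qed

lemma in_cycle_through_self: "permutation f \<Longrightarrow> p \<in> set (cycle_through f p)"
  using cycle_through_permutation(1,2)[of f p] hd_in_set by metis

lemma cycle_through_Cons: "permutation f \<Longrightarrow> \<exists>t. cycle_through f p = p # t"
  using cycle_through_permutation(1,2)[of f p] by (cases "cycle_through f p") auto

lemma image_cycle_through:
  assumes "permutation f" shows "f ` set (cycle_through f p) = set (cycle_through f p)"
  using arg_cong[OF cycle_through_permutation(4)[OF assms, of p], of set] by simp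

text \<open>Since a cycle is determined by the values of the map on its entries, modifying the map elsewhere
  leaves the cycle intact.\<close>

lemma cycle_through_cong:
  assumes "permutation f" "\<And>q. q \<in> set (cycle_through f p) \<Longrightarrow> g q = f q"
  shows "cycle_through g p = cycle_through f p"
proof -
  have "map g (cycle_through f p) = map f (cycle_through f p)" using assms(2) by simp
  then show ?thesis
    using cycle_through_eqI[of "cycle_through f p" g] cycle_through_permutation[OF assms(1)] by metis
qed

lemma cycle_through_rotate:
  assumes f: "permutation f" and q: "q \<in> set (cycle_through f p)"
  shows "\<exists>k. cycle_through f q = rotate k (cycle_through f p)"
proof -
  let ?cs = "cycle_through f p"
  obtain k where k: "k < length ?cs" "?cs ! k = q" using q by (auto simp: in_set_conv_nth)
  note c = cycle_through_permutation[OF f, of p]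
  have hd: "hd (rotate k ?cs) = q" using k c(1) by (simp add: hd_rotate_conv_nth)
  have "map f (rotate k ?cs) = rotate1 (rotate k ?cs)"
    using c(4) by (metis rotate_map rotate1_rotate_swap)
  then have "cycle_through f (hd (rotate k ?cs)) = rotate k ?cs"
    using c by (intro cycle_through_eqI) auto
  then show ?thesis using hd by auto
qed

lemma set_cycle_through_eq:
  "permutation f \<Longrightarrow> q \<in> set (cycle_through f p) \<Longrightarrow> set (cycle_through f q) = set (cycle_through f p)"
  using cycle_through_rotate[of f q p] by auto

lemma cycle_through_sym:
  "permutation f \<Longrightarrow> q \<in> set (cycle_through f p) \<longleftrightarrow> p \<in> set (cycle_through f q)"
  using set_cycle_through_eq in_cycle_through_self by metis

lemma cycle_through_subset:
  assumes "f permutes S" "finite S" "p \<in> S" shows "set (cycle_through f p) \<subseteq> S"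
  using permutes_in_image[OF permutes_funpow[OF assms(1)]] assms(3) by (auto simp: cycle_through_def)

section \<open>Reversing one cycle\<close>

definition reverse_cycle :: "'a \<Rightarrow> ('a \<Rightarrow> 'a) \<Rightarrow> 'a \<Rightarrow> 'a" where
  "reverse_cycle p f = (\<lambda>q. if q \<in> set (cycle_through f p) then Hilbert_Choice.inv f q else f q)"

context
  fixes f :: "'a \<Rightarrow> 'a" and p :: 'a and S :: "'a set"
  assumes f: "f permutes S" and S: "finite S"
begin

private lemma perm: "permutation f"
  using f S permutation_permutes by blast

private lemma inv_closed:
  "q \<in> set (cycle_through f p) \<Longrightarrow> Hilbert_Choice.inv f q \<in> set (cycle_through f p)"
  using image_cycle_through[OF perm, of p] permutes_inverses[OF f] by (metis imageE)

private lemma f_closed: "f q \<in> set (cycle_through f p) \<longleftrightarrow> q \<in> set (cycle_through f p)"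
  using image_cycle_through[OF perm, of p] permutes_inverses[OF f] inv_closed by (metis imageI)

text \<open>In the reversed cycle the starting point \<open>p\<close> stays in front and only the remaining entries are
  reversed; rotating by one place before reversing has this effect.\<close>

lemma cycle_through_reverse_cycle:
  "cycle_through (reverse_cycle p f) p = rev (rotate1 (cycle_through f p))"
proof -
  let ?cs = "cycle_through f p" and ?g = "reverse_cycle p f"
  note c = cycle_through_permutation[OF perm, of p]
  obtain t where t: "?cs = p # t" using cycle_through_Cons[OF perm] by blast
  have "map ?g (rotate1 ?cs) = map (?g \<circ> f) ?cs" unfolding c(4)[symmetric] by simp
  also have "\<dots> = ?cs"
    using f_closed permutes_inverses[OF f] by (intro map_idI) (simp add: reverse_cycle_def)
  finally have "map ?g (rev (rotate1 ?cs)) = rev ?cs" by (simp add: rev_map[symmetric])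
  also have "\<dots> = rotate1 (rev (rotate1 ?cs))" by (simp add: t)
  finally have "cycle_through ?g (hd (rev (rotate1 ?cs))) = rev (rotate1 ?cs)"
    using c by (intro cycle_through_eqI) auto
  then show ?thesis by (simp add: t)
qed

lemma permutes_reverse_cycle: "reverse_cycle p f permutes S"
proof -
  let ?g = "reverse_cycle p f" and ?h = "\<lambda>q. if q \<in> set (cycle_through f p) then f q else Hilbert_Choice.inv f q"
  have invc: "Hilbert_Choice.inv f q \<in> set (cycle_through f p) \<longleftrightarrow> q \<in> set (cycle_through f p)" for q
    using f_closed[of "Hilbert_Choice.inv f q"] permutes_inverses[OF f] by simp
  have "?g \<circ> ?h = id" "?h \<circ> ?g = id"
    using f_closed invc permutes_inverses[OF f] by (auto simp: reverse_cycle_def fun_eq_iff)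
  then have "bij ?g" using o_bij by blast
  moreover have "?g q = q" if "q \<notin> S" for q
    using permutes_not_in[OF f that] permutes_not_in[OF permutes_inv[OF f] that]
    by (simp add: reverse_cycle_def)
  ultimately show ?thesis by (simp add: permutes_def bij_iff)
qed

lemma cycle_through_reverse_cycle_other:
  assumes "q \<notin> set (cycle_through f p)"
  shows "cycle_through (reverse_cycle p f) q = cycle_through f q"
proof (rule cycle_through_cong[OF perm])
  fix r assume "r \<in> set (cycle_through f q)"
  then have "r \<notin> set (cycle_through f p)"
    using assms set_cycle_through_eq[OF perm] in_cycle_through_self[OF perm] by metis
  then show "reverse_cycle p f r = f r" by (simp add: reverse_cycle_def)
qed

lemma set_cycle_through_reverse_cycle:
  "set (cycle_through (reverse_cycle p f) q) = set (cycle_through f q)"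
proof (cases "q \<in> set (cycle_through f p)")
  case True
  have g: "permutation (reverse_cycle p f)" 
    using permutes_reverse_cycle S permutation_permutes by blast
  have "q \<in> set (cycle_through (reverse_cycle p f) p)"
    using True by (simp add: cycle_through_reverse_cycle)
  then have "set (cycle_through (reverse_cycle p f) q) = set (cycle_through (reverse_cycle p f) p)"
    by (rule set_cycle_through_eq[OF g])
  also have "\<dots> = set (cycle_through f q)"
    using set_cycle_through_eq[OF perm True] by (simp add: cycle_through_reverse_cycle)
  finally show ?thesis .
qed (simp add: cycle_through_reverse_cycle_other)

lemma reverse_cycle_involution: "reverse_cycle p (reverse_cycle p f) = f"
proof
  fix q
  have "Hilbert_Choice.inv (reverse_cycle p f) q = f q" if "q \<in> set (cycle_through f p)"
  proof (rule inv_f_eq)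
    show "inj (reverse_cycle p f)" using permutes_reverse_cycle by (rule permutes_inj)
    show "reverse_cycle p f (f q) = q"
      using that f_closed permutes_inverses[OF f] by (simp add: reverse_cycle_def)
  qed
  then show "reverse_cycle p (reverse_cycle p f) q = f q"
    unfolding reverse_cycle_def[of p "reverse_cycle p f"] set_cycle_through_reverse_cycle
    by (simp add: reverse_cycle_def)
qed

end


section \<open>Signed sums over permutations\<close>

text \<open>An involution need not preserve the summands one by one: it is enough that the sums over its
  orbits agree. Doubling the sum over \<open>T\<close> also treats fixed points correctly, which occur when a
  cycle of length one or two is reversed.\<close>

lemma sum_eq_by_involution:
  fixes F G :: "'a \<Rightarrow> 'b::real_vector"
  assumes fin: "finite P" and T: "T \<subseteq> P"
    and \<phi>: "\<And>x. x \<in> T \<Longrightarrow> \<phi> x \<in> T" "\<And>x. x \<in> T \<Longrightarrow> \<phi> (\<phi> x) = x"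
    and out: "\<And>x. x \<in> P - T \<Longrightarrow> F x = G x"
    and pair: "\<And>x. x \<in> T \<Longrightarrow> F x + F (\<phi> x) = G x + G (\<phi> x)"
  shows "sum F P = sum G P"
proof -
  have twice: "sum H T + sum H T = (\<Sum>x\<in>T. H x + H (\<phi> x))" for H :: "'a \<Rightarrow> 'b"
  proof -
    have "sum H T = (\<Sum>x\<in>T. H (\<phi> x))"
      by (rule sum.reindex_bij_witness[of _ \<phi> \<phi>]) (use \<phi> in auto)
    then show ?thesis by (simp add: sum.distrib)
  qed
  have "sum F T + sum F T = sum G T + sum G T"
    unfolding twice using pair by (intro sum.cong) auto
  then have "sum F T = sum G T" by (simp flip: scaleR_2)
  moreover have "sum F (P - T) = sum G (P - T)" using out by (intro sum.cong) auto
  ultimately show ?thesis using sum.subset_diff[OF T fin, of F] sum.subset_diff[OF T fin, of G] by simp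
qed

text \<open>The first entries of the cycles that avoid \<open>i\<close>, in the order in which the row determinant
  multiplies the cycles.\<close>

definition other_heads :: "nat \<Rightarrow> nat \<Rightarrow> (nat \<Rightarrow> nat) \<Rightarrow> nat list" where
  "other_heads n i \<sigma> = filter (\<lambda>p. i \<notin> set (cycle_through \<sigma> p) \<and> p = Min (set (cycle_through \<sigma> p))) [0..<n]"

text \<open>The successor accounts for the cycle through \<open>i\<close>, so that the exponent is \<open>n\<close> minus the number of
  all cycles.\<close>

definition cycle_sign :: "nat \<Rightarrow> nat \<Rightarrow> (nat \<Rightarrow> nat) \<Rightarrow> 'a::ring_1" where
  "cycle_sign n i \<sigma> = (- 1) ^ (n - Suc (length (other_heads n i \<sigma>)))"

lemma cycle_heads_eq: "cycle_heads n i \<sigma> = i # other_heads n i \<sigma>"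
  by (simp add: cycle_heads_def other_heads_def cycle_through_def)

lemma cycle_prod_eq:
  "cycle_prod A \<sigma> p = prod_list (map (\<lambda>q. A $$ (q, \<sigma> q)) (cycle_through \<sigma> p))"
  by (simp only: cycle_prod_def cycle_through_def)

lemma rdet_eq_sum_cycles:
  assumes "A \<in> carrier_mat n n"
  shows "rdet i A = (\<Sum>\<sigma> | \<sigma> permutes {0..<n}. cycle_sign n i \<sigma> *
    (cycle_prod A \<sigma> i * prod_list (map (cycle_prod A \<sigma>) (other_heads n i \<sigma>))))"
  using assms by (simp add: rdet_def cycle_heads_eq cycle_sign_def)

lemma cycle_sign_cases: "cycle_sign n i \<sigma> = (1::'a::ring_1) \<or> cycle_sign n i \<sigma> = (- 1::'a)"
  unfolding cycle_sign_def by (metis neg_one_even_power neg_one_odd_power)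

lemma other_heads_reverse_cycle:
  assumes "\<sigma> permutes {0..<n}"
  shows "other_heads n i (reverse_cycle p \<sigma>) = other_heads n i \<sigma>"
  unfolding other_heads_def set_cycle_through_reverse_cycle[OF assms finite_atLeastLessThan] ..

lemma cycle_sign_reverse_cycle:
  "\<sigma> permutes {0..<n} \<Longrightarrow> cycle_sign n i (reverse_cycle p \<sigma>) = cycle_sign n i \<sigma>"
  by (simp add: cycle_sign_def other_heads_reverse_cycle)

lemma permutation_interval: "\<sigma> permutes {0..<n::nat} \<Longrightarrow> permutation \<sigma>"
  using permutation_permutes by blast

lemma cycle_prod_reverse_cycle_other:
  assumes "\<sigma> permutes {0..<n}" "q \<notin> set (cycle_through \<sigma> p)"
  shows "cycle_prod A (reverse_cycle p \<sigma>) q = cycle_prod A \<sigma> q"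
proof -
  have "r \<notin> set (cycle_through \<sigma> p)" if "r \<in> set (cycle_through \<sigma> q)" for r
    using that assms set_cycle_through_eq[OF permutation_interval] in_cycle_through_self[OF permutation_interval]
    by metis
  then show ?thesis
    unfolding cycle_prod_eq cycle_through_reverse_cycle_other[OF assms(1) finite_atLeastLessThan assms(2)]
    by (intro arg_cong[where f = prod_list] map_cong) (auto simp: reverse_cycle_def)
qed

section \<open>Real parts of cycle products of Hermitian matrices\<close>

lemma of_real_quat: "of_real r = Quat r 0 0 0"
  unfolding of_real_def scaleR_quat_def one_quat_def by simp

lemmas quat_defs = quat_eq_iff zero_quat_def one_quat_def plus_quat_def uminus_quat_def minus_quat_def
  scaleR_quat_def times_quat_def quat_cnj_def of_real_quat

lemma quat_cnj_simps [simp]: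
  "quat_cnj 0 = 0" "quat_cnj 1 = 1" "quat_cnj (p + q) = quat_cnj p + quat_cnj q"
  by (simp_all add: quat_defs)

lemma quat_cnj_mult: "quat_cnj (p * q) = quat_cnj q * quat_cnj p"
  by (simp add: quat_defs algebra_simps)

lemma quat_cnj_prod_list: "quat_cnj (prod_list qs) = prod_list (rev (map quat_cnj qs))"
  by (induction qs) (simp_all add: quat_cnj_mult)

lemma quat_cnj_sum: "quat_cnj (sum f T) = (\<Sum>x\<in>T. quat_cnj (f x))"
  by (induction T rule: infinite_finite_induct) simp_all

lemma quat_add_cnj: "q + quat_cnj q = of_real (qre q) + of_real (qre q)"
  by (simp add: quat_defs)

lemma qre_mult_commute: "qre (p * q) = qre (q * p)"
  by (simp add: quat_defs algebra_simps)

lemma qre_cnj [simp]: "qre (quat_cnj q) = qre q"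
  by (simp add: quat_defs)

lemma of_real_quat_commute: "of_real r * (q::quat) = q * of_real r"
  by (simp add: quat_defs)

text \<open>Replacing row \<open>i\<close> of a Hermitian matrix destroys the symmetry in row and column \<open>i\<close> only, and the
  cycles that avoid \<open>i\<close> do not see these entries. The symmetry is therefore required on a set of
  indices.\<close>

definition hermitian_on :: "nat set \<Rightarrow> quat mat \<Rightarrow> bool" where
  "hermitian_on S A \<longleftrightarrow> (\<forall>p\<in>S. \<forall>q\<in>S. A $$ (q, p) = quat_cnj (A $$ (p, q)))"

lemma hermitian_onD: "hermitian_on S A \<Longrightarrow> p \<in> S \<Longrightarrow> q \<in> S \<Longrightarrow> A $$ (q, p) = quat_cnj (A $$ (p, q))"
  unfolding hermitian_on_def by blast

lemma hermitian_on_subset: "hermitian_on S A \<Longrightarrow> T \<subseteq> S \<Longrightarrow> hermitian_on T A"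
  unfolding hermitian_on_def by blast

text \<open>Traversing a cycle backwards lists the transposed entries in the opposite order. By Hermitian
  symmetry these entries are the conjugates, and conjugation reverses products.\<close>

lemma cycle_prod_reverse_cycle:
  assumes \<sigma>: "\<sigma> permutes {0..<n}" and A: "hermitian_on S A" and sub: "set (cycle_through \<sigma> p) \<subseteq> S"
  shows "cycle_prod A (reverse_cycle p \<sigma>) p = quat_cnj (cycle_prod A \<sigma> p)"
proof -
  let ?cs = "cycle_through \<sigma> p" and ?g = "reverse_cycle p \<sigma>"
  note perm = permutation_interval[OF \<sigma>]
  have img: "q \<in> set ?cs \<Longrightarrow> \<sigma> q \<in> set ?cs" for q
    using image_cycle_through[OF perm, of p] by (metis imageI)
  have "A $$ (\<sigma> q, ?g (\<sigma> q)) = quat_cnj (A $$ (q, \<sigma> q))" if q: "q \<in> set ?cs" for q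
  proof -
    have "?g (\<sigma> q) = q"
      using img[OF q] permutes_inverses(2)[OF \<sigma>, of q] by (simp add: reverse_cycle_def)
    moreover have "A $$ (\<sigma> q, q) = quat_cnj (A $$ (q, \<sigma> q))"
      using q img[OF q] sub by (intro hermitian_onD[OF A]) auto
    ultimately show ?thesis by simp
  qed
  then have "map (\<lambda>q. A $$ (q, ?g q)) (map \<sigma> ?cs) = map quat_cnj (map (\<lambda>q. A $$ (q, \<sigma> q)) ?cs)"
    by simp
  then have entries: "map (\<lambda>q. A $$ (q, ?g q)) (rotate1 ?cs) = map quat_cnj (map (\<lambda>q. A $$ (q, \<sigma> q)) ?cs)"
    by (simp only: cycle_through_permutation(4)[OF perm])
  have "cycle_prod A ?g p = prod_list (rev (map (\<lambda>q. A $$ (q, ?g q)) (rotate1 ?cs)))"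
    by (simp only: cycle_prod_eq cycle_through_reverse_cycle[OF \<sigma> finite_atLeastLessThan] rev_map)
  then show ?thesis
    by (simp only: entries cycle_prod_eq quat_cnj_prod_list)
qed

text \<open>Another starting point rotates the factors, and \<open>Re (p q) = Re (q p)\<close>.\<close>

lemma qre_cycle_prod_same_cycle:
  assumes "permutation \<sigma>" "q \<in> set (cycle_through \<sigma> p)"
  shows "qre (cycle_prod A \<sigma> q) = qre (cycle_prod A \<sigma> p)"
proof -
  obtain k where k: "cycle_through \<sigma> q = rotate k (cycle_through \<sigma> p)"
    using cycle_through_rotate[OF assms] by blast
  let ?m = "k mod length (cycle_through \<sigma> p)" and ?f = "\<lambda>q. A $$ (q, \<sigma> q)"
  define xs ys where "xs = take ?m (cycle_through \<sigma> p)" and "ys = drop ?m (cycle_through \<sigma> p)"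
  have p: "cycle_through \<sigma> p = xs @ ys" by (simp add: xs_def ys_def)
  have q: "cycle_through \<sigma> q = ys @ xs" by (simp only: k rotate_drop_take xs_def ys_def)
  show ?thesis
    unfolding cycle_prod_eq p q by (simp add: qre_mult_commute[of "prod_list (map ?f xs)"])
qed

text \<open>All factors except that of the cycle through \<open>i\<close> may be replaced by their real parts. The
  replacement is done for one possible head \<open>k\<close> at a time: pairing \<open>\<sigma>\<close> with its reversal along the cycle
  of \<open>k\<close> turns the factor \<open>c\<close> of this cycle, in place, into the sum of \<open>c\<close> and its conjugate, which
  is twice the real part.\<close>

lemma rdet_real_parts:
  assumes A: "A \<in> carrier_mat n n" and i: "i < n" and herm: "hermitian_on ({0..<n} - {i}) A"
  shows "rdet i A = (\<Sum>\<sigma> | \<sigma> permutes {0..<n}. cycle_sign n i \<sigma> *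
    (cycle_prod A \<sigma> i * of_real (\<Prod>p\<leftarrow>other_heads n i \<sigma>. qre (cycle_prod A \<sigma> p))))"
proof -
  let ?P = "{\<sigma>. \<sigma> permutes {0..<n}}"
  \<comment> \<open>Intermediate stage of the replacement, with the heads below \<open>k\<close> already treated.\<close>
  define g where "g k \<sigma> p = (if p < k then of_real (qre (cycle_prod A \<sigma> p)) else cycle_prod A \<sigma> p)"
    for k \<sigma> p
  define F where "F k \<sigma> = cycle_sign n i \<sigma> * (cycle_prod A \<sigma> i * prod_list (map (g k \<sigma>) (other_heads n i \<sigma>)))"
    for k \<sigma>
  have step: "sum (F k) ?P = sum (F (Suc k)) ?P" if k: "k < n" for k
  proof (rule sum_eq_by_involution[where T = "{\<sigma> \<in> ?P. k \<in> set (other_heads n i \<sigma>)}"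
        and \<phi> = "reverse_cycle k"])
    show "finite ?P" by (simp add: finite_permutations)
    show "F k \<sigma> = F (Suc k) \<sigma>" if "\<sigma> \<in> ?P - {\<sigma> \<in> ?P. k \<in> set (other_heads n i \<sigma>)}" for \<sigma>
    proof -
      have "map (g k \<sigma>) (other_heads n i \<sigma>) = map (g (Suc k) \<sigma>) (other_heads n i \<sigma>)"
        using that by (auto simp: g_def less_Suc_eq)
      then show ?thesis by (simp only: F_def)
    qed
  next
    fix \<sigma> assume "\<sigma> \<in> {\<sigma> \<in> ?P. k \<in> set (other_heads n i \<sigma>)}"
    then have \<sigma>: "\<sigma> permutes {0..<n}" and kh: "k \<in> set (other_heads n i \<sigma>)" by auto
    note perm = permutation_interval[OF \<sigma>]
    let ?\<tau> = "reverse_cycle k \<sigma>"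
    show "?\<tau> \<in> {\<sigma> \<in> ?P. k \<in> set (other_heads n i \<sigma>)}"
      using \<sigma> kh permutes_reverse_cycle[OF \<sigma>] other_heads_reverse_cycle[OF \<sigma>] by auto
    show "reverse_cycle k ?\<tau> = \<sigma>" by (rule reverse_cycle_involution[OF \<sigma>]) simp
    have ik: "i \<notin> set (cycle_through \<sigma> k)" using kh by (auto simp: other_heads_def)
    define xs ys where "xs = filter (\<lambda>p. i \<notin> set (cycle_through \<sigma> p) \<and> p = Min (set (cycle_through \<sigma> p))) [0..<k]"
      and "ys = filter (\<lambda>p. i \<notin> set (cycle_through \<sigma> p) \<and> p = Min (set (cycle_through \<sigma> p))) [Suc k..<n]"
    have "[0..<n] = [0..<k] @ k # [Suc k..<n]"
      using k upt_add_eq_append[of 0 k "n - k"] upt_conv_Cons[of k n] by simp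
    moreover have "i \<notin> set (cycle_through \<sigma> k) \<and> k = Min (set (cycle_through \<sigma> k))"
      using kh unfolding other_heads_def set_filter by blast
    ultimately have hs: "other_heads n i \<sigma> = xs @ k # ys"
      by (simp only: other_heads_def xs_def ys_def filter_append filter.simps(2) if_True simp_thms)
    have other: "q \<notin> set (cycle_through \<sigma> k)" if "q \<in> set xs \<union> set ys" for q
    proof
      assume "q \<in> set (cycle_through \<sigma> k)"
      then have "set (cycle_through \<sigma> q) = set (cycle_through \<sigma> k)" by (rule set_cycle_through_eq[OF perm])
      moreover have "q = Min (set (cycle_through \<sigma> q))" "q \<noteq> k" using that by (auto simp: xs_def ys_def)
      moreover have "k = Min (set (cycle_through \<sigma> k))" using kh by (auto simp: other_heads_def)
      ultimately show False by simp
    qed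
    define X Y where "X = prod_list (map (g k \<sigma>) xs)" and "Y = prod_list (map (g k \<sigma>) ys)"
    have eqs: "map (g k \<sigma>) xs = map (g (Suc k) \<sigma>) xs" "map (g k \<sigma>) ys = map (g (Suc k) \<sigma>) ys"
      "map (g k ?\<tau>) xs = map (g k \<sigma>) xs" "map (g k ?\<tau>) ys = map (g k \<sigma>) ys"
      "map (g (Suc k) ?\<tau>) xs = map (g (Suc k) \<sigma>) xs" "map (g (Suc k) ?\<tau>) ys = map (g (Suc k) \<sigma>) ys"
      using cycle_prod_reverse_cycle_other[OF \<sigma> other, of _ A] by (auto simp: g_def xs_def ys_def)
    have ci: "cycle_prod A ?\<tau> i = cycle_prod A \<sigma> i"
      by (rule cycle_prod_reverse_cycle_other[OF \<sigma> ik])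
    have "set (cycle_through \<sigma> k) \<subseteq> {0..<n} - {i}"
      using cycle_through_subset[OF \<sigma>, of k] ik k by auto
    then have ck: "cycle_prod A ?\<tau> k = quat_cnj (cycle_prod A \<sigma> k)"
      by (rule cycle_prod_reverse_cycle[OF \<sigma> herm])
    let ?c = "cycle_sign n i \<sigma> * cycle_prod A \<sigma> i"
    \<comment> \<open>The factors to the left of cycle \<open>k\<close> and those to its right agree in both terms.\<close>
    have "F k \<sigma> + F k ?\<tau> = ?c * X * (cycle_prod A \<sigma> k + quat_cnj (cycle_prod A \<sigma> k)) * Y"
      unfolding F_def other_heads_reverse_cycle[OF \<sigma>] cycle_sign_reverse_cycle[OF \<sigma>] hs ci X_def Y_def
      by (simp add: eqs(3,4)) (simp add: g_def ck algebra_simps)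
    also have "\<dots> = F (Suc k) \<sigma> + F (Suc k) ?\<tau>"
      unfolding F_def other_heads_reverse_cycle[OF \<sigma>] cycle_sign_reverse_cycle[OF \<sigma>] hs ci X_def Y_def
        quat_add_cnj
      by (simp add: eqs) (simp add: g_def ck algebra_simps)
    finally show "F k \<sigma> + F k ?\<tau> = F (Suc k) \<sigma> + F (Suc k) ?\<tau>" .
  qed auto
  have steps: "sum (F 0) ?P = sum (F k) ?P" if "k \<le> n" for k
    using that by (induction k) (use step in auto)
  have start: "g 0 \<sigma> = cycle_prod A \<sigma>" for \<sigma> by (simp add: g_def fun_eq_iff)
  have end_prod: "prod_list (map (g n \<sigma>) (other_heads n i \<sigma>))
      = of_real (\<Prod>p\<leftarrow>other_heads n i \<sigma>. qre (cycle_prod A \<sigma> p))" for \<sigma>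
  proof -
    have "map (g n \<sigma>) (other_heads n i \<sigma>) = map (\<lambda>p. of_real (qre (cycle_prod A \<sigma> p))) (other_heads n i \<sigma>)"
      by (auto simp: g_def other_heads_def)
    moreover have "prod_list (map (\<lambda>p. of_real (h p)) ps) = (of_real (\<Prod>p\<leftarrow>ps. h p) :: quat)"
      for h :: "nat \<Rightarrow> real" and ps by (induction ps) simp_all
    ultimately show ?thesis by (simp only:)
  qed
  have "rdet i A = (\<Sum>\<sigma>\<in>?P. F 0 \<sigma>)"
    unfolding rdet_eq_sum_cycles[OF A] F_def start ..
  also have "\<dots> = (\<Sum>\<sigma>\<in>?P. F n \<sigma>)" using steps[of n] by simp
  finally show ?thesis unfolding F_def end_prod .
qed

lemma prod_other_heads_reverse_cycle:
  assumes \<sigma>: "\<sigma> permutes {0..<n}"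
    and p: "\<And>q. q \<in> set (other_heads n i \<sigma>) \<Longrightarrow> q \<notin> set (cycle_through \<sigma> p)"
  shows "(\<Prod>q\<leftarrow>other_heads n i (reverse_cycle p \<sigma>). qre (cycle_prod A (reverse_cycle p \<sigma>) q))
    = (\<Prod>q\<leftarrow>other_heads n i \<sigma>. qre (cycle_prod A \<sigma> q))"
  unfolding other_heads_reverse_cycle[OF \<sigma>]
  using cycle_prod_reverse_cycle_other[OF \<sigma> p, of _ A]
  by (intro arg_cong[where f = prod_list] map_cong) simp_all

section \<open>The determinant of a Hermitian matrix\<close>

text \<open>Unlike the heads used by a row determinant, these representatives of the cycles do not refer to
  a distinguished index.\<close>

definition cycle_minima :: "nat \<Rightarrow> (nat \<Rightarrow> nat) \<Rightarrow> nat set" where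
  "cycle_minima n \<sigma> = {p \<in> {0..<n}. p = Min (set (cycle_through \<sigma> p))}"

text \<open>An expression for the Hermitian determinant that is visibly real and independent of the choice
  of a row.\<close>

definition real_part_det :: "nat \<Rightarrow> quat mat \<Rightarrow> real" where
  "real_part_det n A = (\<Sum>\<sigma> | \<sigma> permutes {0..<n}.
     (- 1) ^ (n - card (cycle_minima n \<sigma>)) * (\<Prod>p\<in>cycle_minima n \<sigma>. qre (cycle_prod A \<sigma> p)))"

lemma distinct_other_heads: "distinct (other_heads n i \<sigma>)"
  by (simp add: other_heads_def)

lemma cycle_minima_eq:
  assumes \<sigma>: "\<sigma> permutes {0..<n}" and i: "i < n"
  defines "m \<equiv> Min (set (cycle_through \<sigma> i))"
  shows "cycle_minima n \<sigma> = insert m (set (other_heads n i \<sigma>))"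
    and "m \<notin> set (other_heads n i \<sigma>)" and "m \<in> set (cycle_through \<sigma> i)"
proof -
  note perm = permutation_interval[OF \<sigma>]
  show m: "m \<in> set (cycle_through \<sigma> i)"
    unfolding m_def using cycle_through_permutation(1)[OF perm] by (intro Min_in) simp_all
  have orb: "set (cycle_through \<sigma> m) = set (cycle_through \<sigma> i)" by (rule set_cycle_through_eq[OF perm m])
  have "m < n" using m cycle_through_subset[OF \<sigma>, of i] i by auto
  show nm: "m \<notin> set (other_heads n i \<sigma>)"
    using orb in_cycle_through_self[OF perm, of i] by (auto simp: other_heads_def)
  have uniq: "p = m" if "i \<in> set (cycle_through \<sigma> p)" "p = Min (set (cycle_through \<sigma> p))" for p
    using set_cycle_through_eq[OF perm that(1)] that(2) unfolding m_def by simp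
  have "m \<in> {0..<n}" "m = Min (set (cycle_through \<sigma> m))"
    using \<open>m < n\<close> by (simp, subst orb, simp only: m_def)
  then have "m \<in> cycle_minima n \<sigma>" unfolding cycle_minima_def by blast
  moreover have "set (other_heads n i \<sigma>) \<subseteq> cycle_minima n \<sigma>"
    unfolding cycle_minima_def other_heads_def set_filter set_upt by blast
  moreover have "cycle_minima n \<sigma> \<subseteq> insert m (set (other_heads n i \<sigma>))"
    using uniq unfolding cycle_minima_def other_heads_def set_filter set_upt by blast
  ultimately show "cycle_minima n \<sigma> = insert m (set (other_heads n i \<sigma>))" by blast
qed

text \<open>When the matrix is Hermitian in row and column \<open>i\<close> too, the cycle through \<open>i\<close> can be averaged with
  its reversal like the others. After that the starting point \<open>i\<close> may be replaced by the minimum of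
  its cycle.\<close>

theorem rdet_hermitian_on:
  assumes A: "A \<in> carrier_mat n n" and herm: "hermitian_on {0..<n} A" and i: "i < n"
  shows "rdet i A = of_real (real_part_det n A)"
proof -
  let ?P = "{\<sigma>. \<sigma> permutes {0..<n}}"
  define R where "R \<sigma> = (\<Prod>p\<leftarrow>other_heads n i \<sigma>. qre (cycle_prod A \<sigma> p))" for \<sigma>
  have "rdet i A = (\<Sum>\<sigma>\<in>?P. cycle_sign n i \<sigma> * (cycle_prod A \<sigma> i * of_real (R \<sigma>)))"
    unfolding R_def by (rule rdet_real_parts[OF A i hermitian_on_subset[OF herm]]) auto
  also have "\<dots> = (\<Sum>\<sigma>\<in>?P. cycle_sign n i \<sigma> * (of_real (qre (cycle_prod A \<sigma> i)) * of_real (R \<sigma>)))"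
  proof (rule sum_eq_by_involution[where T = ?P and \<phi> = "reverse_cycle i"])
    fix \<sigma> assume "\<sigma> \<in> ?P"
    then have \<sigma>: "\<sigma> permutes {0..<n}" by simp
    note perm = permutation_interval[OF \<sigma>]
    let ?\<tau> = "reverse_cycle i \<sigma>"
    show "?\<tau> \<in> ?P" using permutes_reverse_cycle[OF \<sigma>] by simp
    show "reverse_cycle i ?\<tau> = \<sigma>" by (rule reverse_cycle_involution[OF \<sigma>]) simp
    have R: "R ?\<tau> = R \<sigma>"
      unfolding R_def
    proof (rule prod_other_heads_reverse_cycle[OF \<sigma>])
      fix q assume "q \<in> set (other_heads n i \<sigma>)"
      then show "q \<notin> set (cycle_through \<sigma> i)"
        using cycle_through_sym[OF perm, of q i] by (simp add: other_heads_def)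
    qed
    have ci: "cycle_prod A ?\<tau> i = quat_cnj (cycle_prod A \<sigma> i)"
      using i by (intro cycle_prod_reverse_cycle[OF \<sigma> herm] cycle_through_subset[OF \<sigma>]) auto
    have "x * (c * r) + x * (quat_cnj c * r) = x * (of_real (qre c) * r) + x * (of_real (qre c) * r)"
      for x c r :: quat
    proof -
      have "x * (c * r) + x * (quat_cnj c * r) = x * ((c + quat_cnj c) * r)"
        by (simp only: distrib_left distrib_right)
      then show ?thesis by (simp only: quat_add_cnj distrib_left distrib_right)
    qed
    then show "cycle_sign n i \<sigma> * (cycle_prod A \<sigma> i * of_real (R \<sigma>)) +
        cycle_sign n i ?\<tau> * (cycle_prod A ?\<tau> i * of_real (R ?\<tau>)) =
      cycle_sign n i \<sigma> * (of_real (qre (cycle_prod A \<sigma> i)) * of_real (R \<sigma>)) +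
        cycle_sign n i ?\<tau> * (of_real (qre (cycle_prod A ?\<tau> i)) * of_real (R ?\<tau>))"
      unfolding R ci cycle_sign_reverse_cycle[OF \<sigma>] qre_cnj .
  qed (auto simp: finite_permutations)
  also have "\<dots> = (\<Sum>\<sigma>\<in>?P. of_real ((- 1) ^ (n - card (cycle_minima n \<sigma>)) *
      (\<Prod>p\<in>cycle_minima n \<sigma>. qre (cycle_prod A \<sigma> p))))"
  proof (rule sum.cong[OF refl])
    fix \<sigma> assume "\<sigma> \<in> ?P"
    then have \<sigma>: "\<sigma> permutes {0..<n}" by simp
    let ?m = "Min (set (cycle_through \<sigma> i))"
    note min = cycle_minima_eq[OF \<sigma> i]
    have "card (cycle_minima n \<sigma>) = Suc (length (other_heads n i \<sigma>))"
      unfolding min(1) using min(2) distinct_card[OF distinct_other_heads[of n i \<sigma>]] by simp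
    moreover have "(\<Prod>p\<in>cycle_minima n \<sigma>. qre (cycle_prod A \<sigma> p)) = qre (cycle_prod A \<sigma> ?m) * R \<sigma>"
      unfolding min(1) prod.insert[OF finite_set min(2)] R_def
        prod.distinct_set_conv_list[OF distinct_other_heads] ..
    moreover have "qre (cycle_prod A \<sigma> ?m) = qre (cycle_prod A \<sigma> i)"
      by (rule qre_cycle_prod_same_cycle[OF permutation_interval[OF \<sigma>] min(3)])
    ultimately show "cycle_sign n i \<sigma> * (of_real (qre (cycle_prod A \<sigma> i)) * of_real (R \<sigma>)) =
      (of_real ((- 1) ^ (n - card (cycle_minima n \<sigma>)) *
        (\<Prod>p\<in>cycle_minima n \<sigma>. qre (cycle_prod A \<sigma> p))) :: quat)"
      by (simp add: cycle_sign_def)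
  qed
  finally show ?thesis by (simp add: real_part_det_def)
qed

lemma hermitian_mat_imp_hermitian_on:
  assumes A: "A \<in> carrier_mat n n" and herm: "hermitian_mat A"
  shows "hermitian_on {0..<n} A"
  unfolding hermitian_on_def
proof (intro ballI)
  fix p q assume "p \<in> {0..<n}" "q \<in> {0..<n}"
  moreover have "A $$ (q, p) = conj_transpose A $$ (q, p)" using herm by (simp add: hermitian_mat_def)
  ultimately show "A $$ (q, p) = quat_cnj (A $$ (p, q))"
    using A by (simp add: conj_transpose_def)
qed

text \<open>The condition \<open>n \<ge> 1\<close> makes the common value of the row determinants unique.\<close>

lemma hermitian_det_eq:
  assumes A: "A \<in> carrier_mat n n" and n: "n \<ge> 1" and herm: "hermitian_mat A"
  shows "hermitian_det A = real_part_det n A"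
proof -
  have r: "rdet i A = of_real (real_part_det n A)" if "i < n" for i
    by (rule rdet_hermitian_on[OF A hermitian_mat_imp_hermitian_on[OF A herm] that])
  show ?thesis
    unfolding hermitian_det_def
  proof (rule the_equality)
    show "\<forall>i<dim_row A. rdet i A = of_real (real_part_det n A)" using A r by simp
  next
    fix d assume "\<forall>i<dim_row A. rdet i A = of_real d"
    then have "(of_real d :: quat) = of_real (real_part_det n A)" using A n r[of 0] by simp
    then show "d = real_part_det n A" by (simp only: of_real_eq_iff)
  qed
qed

section \<open>Two equal rows\<close>

text \<open>If \<open>\<sigma>\<close> has the cycle \<open>(i x\<^sub>1 \<dots> x\<^sub>r k y\<^sub>1 \<dots> y\<^sub>s)\<close>, then the composition has
  the cycle \<open>(i y\<^sub>1 \<dots> y\<^sub>s)\<close> instead, because it sends \<open>i\<close> to the \<open>\<sigma>\<close>-image of \<open>k\<close>.\<close>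

lemma cycle_through_transpose_split:
  assumes \<sigma>: "permutation \<sigma>" and ik: "i \<noteq> k" and k: "k \<in> set (cycle_through \<sigma> i)"
  shows "k \<notin> set (cycle_through (\<sigma> \<circ> transpose i k) i)"
proof -
  note c = cycle_through_permutation[OF \<sigma>, of i]
  obtain t where t: "cycle_through \<sigma> i = i # t" using cycle_through_Cons[OF \<sigma>] by blast
  then obtain xs ys where "t = xs @ k # ys" using k ik by (auto simp: in_set_conv_decomp)
  with t have cs: "cycle_through \<sigma> i = i # xs @ k # ys" by simp
  have rot: "map \<sigma> (i # xs) @ map \<sigma> (k # ys) = (xs @ [k]) @ (ys @ [i])"
    using c(4) unfolding cs by simp
  then have "map \<sigma> (k # ys) = ys @ [i]" by (subst (asm) append_eq_append_conv) simp_all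
  moreover have "map (\<sigma> \<circ> transpose i k) (i # ys) = map \<sigma> (k # ys)"
    using c(3) unfolding cs by (auto simp: transpose_def)
  ultimately have "map (\<sigma> \<circ> transpose i k) (i # ys) = rotate1 (i # ys)" by simp
  then have "cycle_through (\<sigma> \<circ> transpose i k) (hd (i # ys)) = i # ys"
    using c(3) unfolding cs by (intro cycle_through_eqI) auto
  then show ?thesis using c(3) unfolding cs by auto
qed

lemma cycle_through_transpose_merge:
  assumes \<sigma>: "permutation \<sigma>" and k: "k \<notin> set (cycle_through \<sigma> i)"
  shows "cycle_through (\<sigma> \<circ> transpose i k) i = i # tl (cycle_through \<sigma> k) @ k # tl (cycle_through \<sigma> i)"
proof -
  note c = cycle_through_permutation[OF \<sigma>]
  obtain xs ys where xs: "cycle_through \<sigma> i = i # xs" and ys: "cycle_through \<sigma> k = k # ys"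
    using cycle_through_Cons[OF \<sigma>] by metis
  have disj: "set (i # xs) \<inter> set (k # ys) = {}"
    using k set_cycle_through_eq[OF \<sigma>] in_cycle_through_self[OF \<sigma>] unfolding xs[symmetric] ys[symmetric]
    by blast
  have d: "distinct (i # xs)" "distinct (k # ys)" using c(3)[of i] c(3)[of k] by (simp_all add: xs ys)
  have m: "map \<sigma> (i # xs) = xs @ [i]" "map \<sigma> (k # ys) = ys @ [k]"
    using c(4)[of i] c(4)[of k] by (simp_all add: xs ys)
  have "map (\<sigma> \<circ> transpose i k) (i # ys @ k # xs) = map \<sigma> (k # ys) @ map \<sigma> (i # xs)"
    using d disj by (auto simp: transpose_def)
  also have "\<dots> = rotate1 (i # ys @ k # xs)" unfolding m by simp
  finally have "cycle_through (\<sigma> \<circ> transpose i k) (hd (i # ys @ k # xs)) = i # ys @ k # xs"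
    using d disj by (intro cycle_through_eqI) auto
  then show ?thesis by (simp add: xs ys)
qed

text \<open>With \<open>T\<close> the set of permutations that have \<open>i\<close> and \<open>k\<close> in different cycles, the map
  \<open>\<sigma> \<mapsto> \<sigma> \<circ> t\<close> for the transposition \<open>t\<close> of \<open>i\<close> and \<open>k\<close> is a bijection between \<open>T\<close> and its complement.
  It merges the cycles of \<open>i\<close> and \<open>k\<close>, so the sign changes; equality of the rows \<open>i\<close> and \<open>k\<close> makes the
  factor of the merged cycle the product \<open>c\<^sub>k c\<^sub>i\<close>. In the term of \<open>\<sigma>\<close> the factor \<open>c\<^sub>k\<close> appears through
  its real part only, and reversing the cycle of \<open>k\<close> achieves the same in the term of \<open>\<sigma> \<circ> t\<close>.\<close>

theorem rdet_equal_rows: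
  assumes A: "A \<in> carrier_mat n n" and i: "i < n" and k: "k < n" and ik: "i \<noteq> k"
    and herm: "hermitian_on ({0..<n} - {i}) A" and rows: "\<And>q. q < n \<Longrightarrow> A $$ (i, q) = A $$ (k, q)"
  shows "rdet i A = 0"
proof -
  let ?P = "{\<sigma>. \<sigma> permutes {0..<n}}"
  define T where "T = {\<sigma> \<in> ?P. k \<notin> set (cycle_through \<sigma> i)}"
  define R where "R \<sigma> = (\<Prod>p\<leftarrow>other_heads n i \<sigma>. qre (cycle_prod A \<sigma> p))" for \<sigma>
  define W where "W \<sigma> = cycle_sign n i \<sigma> * (cycle_prod A \<sigma> i * of_real (R \<sigma>))" for \<sigma>
  define t where "t = transpose i k"
  \<comment> \<open>The heads of the cycles that contain neither \<open>i\<close> nor \<open>k\<close>; they are common to \<open>\<sigma>\<close> and \<open>\<sigma> \<circ> t\<close>.\<close>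
  define Q where "Q \<sigma> = {p \<in> {0..<n}. p \<notin> set (cycle_through \<sigma> i) \<union> set (cycle_through \<sigma> k)
      \<and> p = Min (set (cycle_through \<sigma> p))}" for \<sigma>
  define R' where "R' \<sigma> = (\<Prod>p\<in>Q \<sigma>. qre (cycle_prod A \<sigma> p))" for \<sigma>
  have tt: "\<sigma> \<circ> t \<circ> t = \<sigma>" for \<sigma> :: "nat \<Rightarrow> nat" by (simp add: t_def comp_assoc)
  have t_perm: "\<sigma> \<circ> t permutes {0..<n}" if "\<sigma> permutes {0..<n}" for \<sigma>
    unfolding t_def using that i k by (intro permutes_compose permutes_swap_id) auto
  have split: "\<sigma> \<circ> t \<in> T" if "\<sigma> \<in> ?P - T" for \<sigma>
    using that t_perm[of \<sigma>] cycle_through_transpose_split[OF permutation_interval[of \<sigma> n] ik]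
    by (auto simp: T_def t_def)

  have merge: "\<sigma> \<circ> t \<in> ?P - T"
      "cycle_prod A (\<sigma> \<circ> t) i = cycle_prod A \<sigma> k * cycle_prod A \<sigma> i"
      "R (\<sigma> \<circ> t) = R' \<sigma>" "R \<sigma> = qre (cycle_prod A \<sigma> k) * R' \<sigma>"
      "cycle_sign n i (\<sigma> \<circ> t) = - (cycle_sign n i \<sigma> :: quat)"
    if "\<sigma> \<in> T" for \<sigma>
  proof -
    have \<sigma>: "\<sigma> permutes {0..<n}" and ki: "k \<notin> set (cycle_through \<sigma> i)" using that by (auto simp: T_def)
    note perm = permutation_interval[OF \<sigma>] and perm' = permutation_interval[OF t_perm[OF \<sigma>]]
    note cs = cycle_through_transpose_merge[OF perm ki, folded t_def]
    obtain xs ys where xs: "cycle_through \<sigma> i = i # xs" and ys: "cycle_through \<sigma> k = k # ys"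
      using cycle_through_Cons[OF perm] by metis
    have d: "distinct (i # xs)" "distinct (k # ys)"
      using cycle_through_permutation(3)[OF perm] xs ys by metis+
    have disj: "set (i # xs) \<inter> set (k # ys) = {}"
      using ki set_cycle_through_eq[OF perm] in_cycle_through_self[OF perm] unfolding xs[symmetric] ys[symmetric]
      by blast
    show "\<sigma> \<circ> t \<in> ?P - T" using t_perm[OF \<sigma>] by (simp add: T_def cs)
    have ti: "t i = k" "t k = i" and tother: "\<And>q. q \<in> set xs \<union> set ys \<Longrightarrow> t q = q"
      using d disj by (auto simp: t_def transpose_def)
    have "\<sigma> k < n" "\<sigma> i < n" using i k permutes_in_image[OF \<sigma>] by auto
    then show "cycle_prod A (\<sigma> \<circ> t) i = cycle_prod A \<sigma> k * cycle_prod A \<sigma> i"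
      unfolding cycle_prod_eq cs xs ys using tother rows by (simp add: ti mult.assoc cong: map_cong)
    have orb_i: "set (cycle_through (\<sigma> \<circ> t) i) = set (cycle_through \<sigma> i) \<union> set (cycle_through \<sigma> k)"
      unfolding cs xs ys by auto
    have other: "cycle_through (\<sigma> \<circ> t) p = cycle_through \<sigma> p"
      if "p \<notin> set (cycle_through \<sigma> i) \<union> set (cycle_through \<sigma> k)" for p
    proof (rule cycle_through_cong[OF perm])
      fix q assume "q \<in> set (cycle_through \<sigma> p)"
      then have "q \<noteq> i" "q \<noteq> k" using that cycle_through_sym[OF perm, of p] by auto
      then show "(\<sigma> \<circ> t) q = \<sigma> q" by (simp add: t_def transpose_def)
    qed
    have hs: "set (other_heads n i (\<sigma> \<circ> t)) = Q \<sigma>"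
    proof -
      have "i \<notin> set (cycle_through (\<sigma> \<circ> t) p) \<longleftrightarrow> p \<notin> set (cycle_through \<sigma> i) \<union> set (cycle_through \<sigma> k)" for p
        using cycle_through_sym[OF perm', of i p] orb_i by auto
      then show ?thesis unfolding other_heads_def Q_def using other by auto
    qed
    let ?m = "Min (set (cycle_through \<sigma> k))"
    note min = cycle_minima_eq[OF \<sigma> k]
    have orb_m: "set (cycle_through \<sigma> ?m) = set (cycle_through \<sigma> k)"
      by (rule set_cycle_through_eq[OF perm min(3)])
    have mn: "?m < n" using min(3) cycle_through_subset[OF \<sigma>, of k] k by auto
    have im: "i \<notin> set (cycle_through \<sigma> ?m)"
      using orb_m ki cycle_through_sym[OF perm] by auto
    have hs': "set (other_heads n i \<sigma>) = insert ?m (Q \<sigma>)"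
    proof -
      have "p = ?m" if "p \<in> set (cycle_through \<sigma> k)" "p = Min (set (cycle_through \<sigma> p))" for p
        using set_cycle_through_eq[OF perm that(1)] that(2) by simp
      moreover have "?m = Min (set (cycle_through \<sigma> ?m))" unfolding orb_m ..
      moreover have "?m \<in> {0..<n}" using mn by simp
      moreover have "i \<notin> set (cycle_through \<sigma> p) \<longleftrightarrow> p \<notin> set (cycle_through \<sigma> i)" for p
        using cycle_through_sym[OF perm, of i p] by simp
      ultimately show ?thesis
        using im unfolding other_heads_def Q_def set_filter set_upt by blast
    qed
    have mQ: "?m \<notin> Q \<sigma>" using min(3) by (simp add: Q_def)
    have finQ: "finite (Q \<sigma>)" by (simp add: Q_def)
    have len: "length (other_heads n i (\<sigma> \<circ> t)) = card (Q \<sigma>)" "length (other_heads n i \<sigma>) = Suc (card (Q \<sigma>))"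
      using distinct_card[OF distinct_other_heads, of n i] hs hs' mQ finQ by (metis card_insert_disjoint)+
    \<comment> \<open>The index \<open>i\<close> is never one of the other heads, so the truncated subtraction in the exponent of the sign is harmless.\<close>
    have "insert ?m (Q \<sigma>) \<subseteq> {0..<n} - {i}"
      using hs'[symmetric] in_cycle_through_self[OF perm] by (auto simp: other_heads_def)
    then have "card (insert ?m (Q \<sigma>)) \<le> card ({0..<n} - {i})" by (intro card_mono) auto
    then have "Suc (Suc (card (Q \<sigma>))) \<le> n" using i mQ finQ by simp
    then have "n - Suc (card (Q \<sigma>)) = Suc (n - Suc (Suc (card (Q \<sigma>))))" by simp
    then show "cycle_sign n i (\<sigma> \<circ> t) = - (cycle_sign n i \<sigma> :: quat)"
      unfolding cycle_sign_def len by simp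
    have "(\<Prod>p\<in>Q \<sigma>. qre (cycle_prod A (\<sigma> \<circ> t) p)) = (\<Prod>p\<in>Q \<sigma>. qre (cycle_prod A \<sigma> p))"
    proof (rule prod.cong[OF refl])
      fix p assume "p \<in> Q \<sigma>"
      then have p: "p \<notin> set (cycle_through \<sigma> i) \<union> set (cycle_through \<sigma> k)" by (simp add: Q_def)
      have "t q = q" if "q \<in> set (cycle_through \<sigma> p)" for q
        using that p cycle_through_sym[OF perm, of p] by (auto simp: t_def transpose_def)
      then show "qre (cycle_prod A (\<sigma> \<circ> t) p) = qre (cycle_prod A \<sigma> p)"
        unfolding cycle_prod_eq other[OF p] by (simp cong: map_cong)
    qed
    then show "R (\<sigma> \<circ> t) = R' \<sigma>"
      unfolding R_def R'_def prod.distinct_set_conv_list[OF distinct_other_heads, symmetric] hs .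
    show "R \<sigma> = qre (cycle_prod A \<sigma> k) * R' \<sigma>"
      unfolding R_def R'_def prod.distinct_set_conv_list[OF distinct_other_heads, symmetric] hs hs'
      using mQ finQ qre_cycle_prod_same_cycle[OF perm min(3)] by simp
  qed

  have "sum W (?P - T) = (\<Sum>\<sigma>\<in>T. W (\<sigma> \<circ> t))"
    by (rule sum.reindex_bij_witness[of _ "\<lambda>\<sigma>. \<sigma> \<circ> t" "\<lambda>\<sigma>. \<sigma> \<circ> t"]) (use split merge(1) tt in auto)
  also have "\<dots> = (\<Sum>\<sigma>\<in>T. - W \<sigma>)"
  proof (rule sum_eq_by_involution[where T = T and \<phi> = "reverse_cycle k"])
    show "finite T" by (simp add: T_def finite_permutations)
    fix \<sigma> assume "\<sigma> \<in> T"
    then have \<sigma>: "\<sigma> permutes {0..<n}" and ki: "k \<notin> set (cycle_through \<sigma> i)" by (auto simp: T_def)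
    note perm = permutation_interval[OF \<sigma>]
    let ?\<tau> = "reverse_cycle k \<sigma>"
    have ik': "i \<notin> set (cycle_through \<sigma> k)" using ki cycle_through_sym[OF perm] by metis
    show \<tau>: "?\<tau> \<in> T"
      using permutes_reverse_cycle[OF \<sigma>] set_cycle_through_reverse_cycle[OF \<sigma>] ki by (simp add: T_def)
    show "reverse_cycle k ?\<tau> = \<sigma>" by (rule reverse_cycle_involution[OF \<sigma>]) simp
    have ci: "cycle_prod A ?\<tau> i = cycle_prod A \<sigma> i"
      by (rule cycle_prod_reverse_cycle_other[OF \<sigma> ik'])
    have "set (cycle_through \<sigma> k) \<subseteq> {0..<n} - {i}"
      using cycle_through_subset[OF \<sigma>, of k] ik' k by auto
    then have ck: "cycle_prod A ?\<tau> k = quat_cnj (cycle_prod A \<sigma> k)"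
      by (rule cycle_prod_reverse_cycle[OF \<sigma> herm])
    have "Q ?\<tau> = Q \<sigma>" unfolding Q_def set_cycle_through_reverse_cycle[OF \<sigma> finite_atLeastLessThan] ..
    then have R: "R' ?\<tau> = R' \<sigma>"
      unfolding R'_def using cycle_prod_reverse_cycle_other[OF \<sigma>, of _ k A]
      by (intro prod.cong) (auto simp: Q_def)
    note m = merge[OF \<open>\<sigma> \<in> T\<close>] and m' = merge[OF \<tau>]
    show "W (\<sigma> \<circ> t) + W (?\<tau> \<circ> t) = - W \<sigma> + - W ?\<tau>"
    proof -
      have alg: "- x * (c * a * r) + - x * (quat_cnj c * a * r)
          = - (x * (a * (of_real (qre c) * r))) + - (x * (a * (of_real (qre c) * r)))" for x a c r :: quat
      proof -
        have "- x * (c * a * r) + - x * (quat_cnj c * a * r) = - x * ((c + quat_cnj c) * a * r)"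
          by (simp only: distrib_left distrib_right)
        also have "\<dots> = - x * ((a * of_real (qre c) + a * of_real (qre c)) * r)"
          by (simp only: quat_add_cnj distrib_right of_real_quat_commute)
        finally show ?thesis by (simp add: algebra_simps)
      qed
      show ?thesis
        unfolding W_def m(2-5) m'(2-5) R ci ck qre_cnj cycle_sign_reverse_cycle[OF \<sigma>] of_real_mult
        by (rule alg)
    qed
  qed auto
  finally have "sum W (?P - T) = - sum W T" by (simp add: sum_negf)
  moreover have "sum W ?P = sum W (?P - T) + sum W T"
    by (rule sum.subset_diff) (auto simp: T_def finite_permutations)
  moreover have "rdet i A = sum W ?P"
    unfolding W_def R_def by (rule rdet_real_parts[OF A i herm])
  ultimately show ?thesis by simp
qed

section \<open>Cramer's rule\<close>

text \<open>The cycle through \<open>i\<close> is written first and starts with \<open>i\<close>, so the entry taken from row \<open>i\<close> is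
  the leftmost factor of every term, up to the central sign. No other factor involves row \<open>i\<close>.\<close>

lemma rdet_replace_row_expand:
  fixes A :: "'a::ring_1 mat"
  assumes A: "A \<in> carrier_mat n n" and i: "i < n" and v: "dim_vec v = n"
  shows "rdet i (replace_row A i v) = (\<Sum>j\<in>{0..<n}. v $ j * rdet i (replace_row A i (unit_vec n j)))"
proof -
  let ?P = "{\<sigma>. \<sigma> permutes {0..<n}}"
  define c where "c \<sigma> = prod_list (map (\<lambda>q. A $$ (q, \<sigma> q)) (tl (cycle_through \<sigma> i)))
      * prod_list (map (cycle_prod A \<sigma>) (other_heads n i \<sigma>))" for \<sigma>
  have expand: "rdet i (replace_row A i w) = (\<Sum>\<sigma>\<in>?P. cycle_sign n i \<sigma> * (w $ \<sigma> i * c \<sigma>))"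
    if w: "dim_vec w = n" for w
  proof -
    let ?M = "replace_row A i w"
    have M: "?M \<in> carrier_mat n n" using A by (simp add: replace_row_def)
    show ?thesis
      unfolding rdet_eq_sum_cycles[OF M]
    proof (rule sum.cong[OF refl])
      fix \<sigma> assume "\<sigma> \<in> ?P"
      then have \<sigma>: "\<sigma> permutes {0..<n}" by simp
      note perm = permutation_interval[OF \<sigma>]
      have lt: "\<sigma> q < n" if "q < n" for q using permutes_in_image[OF \<sigma>, of q] that by simp
      have ent: "?M $$ (q, \<sigma> q) = A $$ (q, \<sigma> q)" if "q < n" "q \<noteq> i" for q
        using that lt A by (simp add: replace_row_def)
      have enti: "?M $$ (i, \<sigma> i) = w $ \<sigma> i" using i lt A by (simp add: replace_row_def)
      obtain t where t: "cycle_through \<sigma> i = i # t" using cycle_through_Cons[OF perm] by blast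
      have "set t \<subseteq> {0..<n}" "i \<notin> set t"
        using cycle_through_subset[OF \<sigma>, of i] i cycle_through_permutation(3)[OF perm, of i] t by auto
      then have "map (\<lambda>q. ?M $$ (q, \<sigma> q)) t = map (\<lambda>q. A $$ (q, \<sigma> q)) t"
        by (intro map_cong refl ent) auto
      then have ci: "cycle_prod ?M \<sigma> i = w $ \<sigma> i * prod_list (map (\<lambda>q. A $$ (q, \<sigma> q)) (tl (cycle_through \<sigma> i)))"
        unfolding cycle_prod_eq t by (simp only: list.map list.sel prod_list.Cons enti)
      have "cycle_prod ?M \<sigma> p = cycle_prod A \<sigma> p" if "p \<in> set (other_heads n i \<sigma>)" for p
      proof -
        have "p < n" "i \<notin> set (cycle_through \<sigma> p)" using that by (auto simp: other_heads_def)
        then show ?thesis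
          unfolding cycle_prod_eq using cycle_through_subset[OF \<sigma>, of p]
          by (intro arg_cong[where f = prod_list] map_cong refl ent) auto
      qed
      then have "map (cycle_prod ?M \<sigma>) (other_heads n i \<sigma>) = map (cycle_prod A \<sigma>) (other_heads n i \<sigma>)"
        by simp
      then show "cycle_sign n i \<sigma> * (cycle_prod ?M \<sigma> i * prod_list (map (cycle_prod ?M \<sigma>) (other_heads n i \<sigma>)))
          = cycle_sign n i \<sigma> * (w $ \<sigma> i * c \<sigma>)"
        by (simp only: ci c_def mult.assoc)
    qed
  qed
  have "rdet i (replace_row A i v) = (\<Sum>\<sigma>\<in>?P. cycle_sign n i \<sigma> * (v $ \<sigma> i * c \<sigma>))"
    by (rule expand[OF v])
  also have "\<dots> = (\<Sum>\<sigma>\<in>?P. \<Sum>j\<in>{0..<n}. v $ j * (cycle_sign n i \<sigma> * (unit_vec n j $ \<sigma> i * c \<sigma>)))"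
  proof (rule sum.cong[OF refl])
    fix \<sigma> assume "\<sigma> \<in> ?P"
    then have s: "\<sigma> i \<in> {0..<n}" using i permutes_in_image[of \<sigma> "{0..<n}" i] by simp
    have sgn: "x * cycle_sign n i \<sigma> = cycle_sign n i \<sigma> * x" for x :: 'a
      using cycle_sign_cases[of n i \<sigma>, where ?'a = 'a] by auto
    have "(\<Sum>j\<in>{0..<n}. v $ j * (cycle_sign n i \<sigma> * (unit_vec n j $ \<sigma> i * c \<sigma>)))
        = (\<Sum>j\<in>{0..<n}. if \<sigma> i = j then v $ j * (cycle_sign n i \<sigma> * c \<sigma>) else 0)"
      using s by (intro sum.cong) auto
    also have "\<dots> = v $ \<sigma> i * (cycle_sign n i \<sigma> * c \<sigma>)" using s by simp
    also have "\<dots> = cycle_sign n i \<sigma> * (v $ \<sigma> i * c \<sigma>)" by (simp only: mult.assoc[symmetric] sgn)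
    finally show "cycle_sign n i \<sigma> * (v $ \<sigma> i * c \<sigma>)
        = (\<Sum>j\<in>{0..<n}. v $ j * (cycle_sign n i \<sigma> * (unit_vec n j $ \<sigma> i * c \<sigma>)))" ..
  qed
  also have "\<dots> = (\<Sum>j\<in>{0..<n}. v $ j * rdet i (replace_row A i (unit_vec n j)))"
    by (subst sum.swap) (simp add: expand sum_distrib_left)
  finally show ?thesis .
qed

lemma rdet_replace_row_by_row:
  assumes A: "A \<in> carrier_mat n n" and n: "n \<ge> 1" and herm: "hermitian_mat A" and i: "i < n" and k: "k < n"
  shows "rdet i (replace_row A i (row A k)) = (if k = i then of_real (hermitian_det A) else 0)"
proof (cases "k = i")
  case True
  have "replace_row A i (row A i) = A"
    using A i by (intro eq_matI) (auto simp: replace_row_def)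
  then show ?thesis
    using True rdet_hermitian_on[OF A hermitian_mat_imp_hermitian_on[OF A herm] i]
      hermitian_det_eq[OF A n herm] by simp
next
  case False
  let ?M = "replace_row A i (row A k)"
  have "rdet i ?M = 0"
  proof (rule rdet_equal_rows[OF _ i k])
    show "?M \<in> carrier_mat n n" using A by (simp add: replace_row_def)
    have "hermitian_on {0..<n} A" by (rule hermitian_mat_imp_hermitian_on[OF A herm])
    then have "?M $$ (q, p) = quat_cnj (?M $$ (p, q))" if "p \<in> {0..<n} - {i}" "q \<in> {0..<n} - {i}" for p q
      using hermitian_onD[of "{0..<n}" A p q] that A by (simp add: replace_row_def)
    then show "hermitian_on ({0..<n} - {i}) ?M" unfolding hermitian_on_def by blast
    show "?M $$ (i, q) = ?M $$ (k, q)" if "q < n" for q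
      using A i k False that by (simp add: replace_row_def)
  qed (use False in simp)
  then show ?thesis using False by simp
qed

lemma conj_transpose_mult:
  assumes "A \<in> carrier_mat m n" "B \<in> carrier_mat n l"
  shows "conj_transpose (A * B) = conj_transpose B * conj_transpose A"
  using assms unfolding conj_transpose_def
  by (intro eq_matI) (auto simp: scalar_prod_def quat_cnj_sum quat_cnj_mult intro!: sum.cong)

lemma conj_transpose_one: "conj_transpose (1\<^sub>m n) = 1\<^sub>m n"
  unfolding conj_transpose_def by (intro eq_matI) auto

definition cofactor_inverse :: "nat \<Rightarrow> quat mat \<Rightarrow> quat mat" where
  "cofactor_inverse n A =
     mat n n (\<lambda>(j, i). rdet i (replace_row A i (unit_vec n j)) / of_real (hermitian_det A))"

lemma mult_cofactor_inverse:
  assumes A: "A \<in> carrier_mat n n" and y: "y \<in> carrier_mat m n" and k: "k < m" and i: "i < n"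
  shows "(y * cofactor_inverse n A) $$ (k, i) = rdet i (replace_row A i (row y k)) / of_real (hermitian_det A)"
proof -
  have "dim_vec (row y k) = n" using y by simp
  then show ?thesis
    using y k i unfolding rdet_replace_row_expand[OF A i \<open>dim_vec (row y k) = n\<close>]
    by (simp add: cofactor_inverse_def scalar_prod_def divide_inverse sum_distrib_right mult.assoc)
qed

text \<open>The expansion along row \<open>i\<close> yields a right inverse only. That it is also a left inverse
  follows from the Hermitian symmetry: its conjugate transpose is a left inverse, and a left and a
  right inverse coincide.\<close>

lemma cofactor_inverse:
  assumes A: "A \<in> carrier_mat n n" and n: "n \<ge> 1" and herm: "hermitian_mat A"
    and det: "hermitian_det A \<noteq> 0"
  shows "A * cofactor_inverse n A = 1\<^sub>m n" and "cofactor_inverse n A * A = 1\<^sub>m n"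
proof -
  let ?B = "cofactor_inverse n A" and ?C = "conj_transpose (cofactor_inverse n A)"
  have B: "?B \<in> carrier_mat n n" by (simp add: cofactor_inverse_def)
  then have C: "?C \<in> carrier_mat n n" by (simp add: conj_transpose_def)
  show AB: "A * ?B = 1\<^sub>m n"
  proof (rule eq_matI)
    fix k i assume "k < dim_row (1\<^sub>m n :: quat mat)" "i < dim_col (1\<^sub>m n :: quat mat)"
    then have k: "k < n" and i: "i < n" by simp_all
    show "(A * ?B) $$ (k, i) = 1\<^sub>m n $$ (k, i)"
      unfolding mult_cofactor_inverse[OF A A k i] rdet_replace_row_by_row[OF A n herm i k]
      using det k i by simp
  qed (use A B in auto)
  have CA: "?C * A = 1\<^sub>m n"
    using conj_transpose_mult[OF A B] herm unfolding AB conj_transpose_one hermitian_mat_def by simp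
  have "?C = ?C * (A * ?B)" unfolding AB by (rule right_mult_one_mat[OF C, symmetric])
  also have "\<dots> = ?C * A * ?B" by (rule assoc_mult_mat[OF C A B, symmetric])
  also have "\<dots> = ?B" unfolding CA by (rule left_mult_one_mat[OF B])
  finally show "?B * A = 1\<^sub>m n" using CA by (simp only:)
qed

theorem theorem9p4:
  fixes n :: nat and A y :: "quat mat"
  assumes "n \<ge> 1"
    and "A \<in> carrier_mat n n"
    and "y \<in> carrier_mat 1 n"
    and "hermitian_mat A"
    and "hermitian_det A \<noteq> 0"
  shows "(\<exists>!x. x \<in> carrier_mat 1 n \<and> x * A = y) \<and>
    (\<forall>x. x \<in> carrier_mat 1 n \<and> x * A = y \<longrightarrow>
      (\<forall>i<n. x $$ (0, i) = rdet i (replace_row A i (row y 0)) / of_real (hermitian_det A)))"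
proof -
  note A = \<open>A \<in> carrier_mat n n\<close> and y = \<open>y \<in> carrier_mat 1 n\<close>
  let ?B = "cofactor_inverse n A"
  note inv = cofactor_inverse[OF A assms(1,4,5)]
  have B: "?B \<in> carrier_mat n n" by (simp add: cofactor_inverse_def)
  have solution: "x = y * ?B" if x: "x \<in> carrier_mat 1 n" and eq: "x * A = y" for x
  proof -
    have "x = x * (A * ?B)" unfolding inv(1) by (rule right_mult_one_mat[OF x, symmetric])
    also have "\<dots> = x * A * ?B" by (rule assoc_mult_mat[OF x A B, symmetric])
    finally show ?thesis unfolding eq .
  qed
  have "y * ?B * A = y * (?B * A)" by (rule assoc_mult_mat[OF y B A])
  also have "\<dots> = y" unfolding inv(2) by (rule right_mult_one_mat[OF y])
  finally have "\<exists>!x. x \<in> carrier_mat 1 n \<and> x * A = y"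
    using solution mult_carrier_mat[OF y B] by (intro ex1I[of _ "y * ?B"]) blast+
  moreover have "x $$ (0, i) = rdet i (replace_row A i (row y 0)) / of_real (hermitian_det A)"
    if "x \<in> carrier_mat 1 n" "x * A = y" "i < n" for x i
    unfolding solution[OF that(1,2)] by (rule mult_cofactor_inverse[OF A y _ that(3)]) simp
  ultimately show ?thesis by blast
qed

end
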